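(* Let $I=[0,\infty)$, let $s\in(0,1]$, let $f,g\in SX((h-s)_2,I)$, let $h$ be super-multiplicative, and let $f,g$ be similarly ordered functions on $I$. Let $a,b\in I$ with $a<b$. If $f,g,fg\in L_1[a,b]$ and $h\in L_1[0,1]$, then $$\frac{g(b)}{b-a}\int_a^b h^s\!\left(\frac{x-a}{b-a}\right)f(x)\,dx+\frac{g(a)}{b-a}\int_a^b h^s\!\left(\frac{b-x}{b-a}\right)f(x)\,dx$$ $$+\frac{f(b)}{b-a}\int_a^b h^s\!\left(\frac{x-a}{b-a}\right)g(x)\,dx+\frac{f(a)}{b-a}\int_a^b h^s\!\left(\frac{b-x}{b-a}\right)g(x)\,dx$$ $$\le \frac{1}{b-a}\int_a^b f(x)g(x)\,dx+f(b)g(b)\int_0^1\left[h^s(t-t^2)+h^s(t^2)\right]dt+f(a)g(a)\int_0^1\left[h^s((1-t)^2)+h^s(t-t^2)\right]dt.$$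
   Context: Notation: $h^s(t)=(h(t))^s$. Definition of $SX((h-s)_2,I)$: let $h:J\subset\mathbb{R}\to\mathbb{R}$ be a non-negative function, $h\neq 0$, defined at all points of $[0,1]$ (where it is evaluated), and let $s\in(0,1]$. A function $f:I=[0,\infty)\to\mathbb{R}$ is $(h-s)_2$-convex (in the second sense), written $f\in SX((h-s)_2,I)$, if $f$ is non-negative and for all $u,v\in I$ and $t\in[0,1]$, $$f(tu+(1-t)v)\le h^s(t)f(u)+h^s(1-t)f(v).$$ A function $h:J\to\mathbb{R}$ is super-multiplicative if $h(xy)\ge h(x)h(y)$ for all $x,y\in J$. Functions $f,g:X\to\mathbb{R}$ are similarly ordered if $(f(x)-f(y))(g(x)-g(y))\ge 0$ for every $x,y\in X$. *)

theory Defs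
  imports "HOL-Analysis.Analysis"
begin

text \<open>
  Real functions on a subset of the reals are total functions whose values matter only on that
  subset.  The power \<open>h t powr s\<close> is \<open>(h t)\<^sup>s\<close> for \<open>h t \<ge> 0\<close> and \<open>s > 0\<close>, including
  \<open>0 powr s = 0\<close>.

  The standing conditions on \<open>h\<close> and \<open>s\<close> (\<open>h\<close> non-negative and not identically zero on a set
  \<open>J\<close> containing the unit interval, \<open>0 < s \<le> 1\<close>) are not part of the following definition and are
  to be assumed where it is used.
\<close>

definition SX2 :: "(real \<Rightarrow> real) \<Rightarrow> real \<Rightarrow> real set \<Rightarrow> (real \<Rightarrow> real) set" where
  "SX2 h s I = {f. (\<forall>x\<in>I. 0 \<le> f x) \<and>
     (\<forall>u\<in>I. \<forall>v\<in>I. \<forall>t\<in>{0..1}.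
        f (t * u + (1 - t) * v) \<le> h t powr s * f u + h (1 - t) powr s * f v)}"

text \<open>
  The inequality is required only where its left-hand side is defined, since \<open>J\<close> need not be
  closed under multiplication.
\<close>

definition super_multiplicative_on :: "real set \<Rightarrow> (real \<Rightarrow> real) \<Rightarrow> bool" where
  "super_multiplicative_on J h \<longleftrightarrow>
     (\<forall>x\<in>J. \<forall>y\<in>J. x * y \<in> J \<longrightarrow> h (x * y) \<ge> h x * h y)"

definition similarly_ordered_on :: "'a set \<Rightarrow> ('a \<Rightarrow> real) \<Rightarrow> ('a \<Rightarrow> real) \<Rightarrow> bool" where
  "similarly_ordered_on X f g \<longleftrightarrow> (\<forall>x\<in>X. \<forall>y\<in>X. (f x - f y) * (g x - g y) \<ge> 0)"

text \<open>
  Integrability of \<open>h\<close> on the unit interval does not make \<open>h (t\<^sup>2) powr s\<close> integrable: for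
  \<open>s = 1\<close>, take \<open>h t = t powr (-4/5)\<close> (so \<open>h 0 = 0\<close>), which is multiplicative on \<open>{0..}\<close> and
  admits all non-negative constants in \<open>SX2 h s {0..}\<close>.  Inequalities between such integrals of
  non-negative functions are therefore stated with Lebesgue integrals valued in \<open>[0, \<infinity>]\<close>.
  A Bochner integral would be \<open>0\<close> in the divergent case; in the convergent case both agree.
\<close>

end

theory Submission
  imports Defs
begin

text \<open>
  Write \<open>x = t b + (1 - t) a\<close> and let \<open>F = h\<^sup>s(t) f(b) + h\<^sup>s(1 - t) f(a)\<close> and
  \<open>G = h\<^sup>s(t) g(b) + h\<^sup>s(1 - t) g(a)\<close> be the upper bounds for \<open>f(x)\<close> and \<open>g(x)\<close>.  Expanding
  \<open>(F - f(x)) (G - g(x)) \<ge> 0\<close> gives \<open>G f(x) + F g(x) \<le> f(x) g(x) + F G\<close>.  In \<open>F G\<close> the mixed terms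
  are estimated by similar ordering and the products of values of \<open>h\<^sup>s\<close> by super-multiplicativity;
  then one integrates over \<open>x\<close>.

  Since the integrals may diverge, additivity on the right-hand side rests on the Lebesgue
  measurability of \<open>h(t\<^sup>2)\<close>, \<open>h(t - t\<^sup>2)\<close> and \<open>h((1 - t)\<^sup>2)\<close>.  It holds because preimages of null
  sets under these polynomials are null, their derivatives having only isolated zeros.
\<close>

lemma borel_measurable_lebesgue_on_compose_differentiable:
  fixes h :: "real \<Rightarrow> 'a::euclidean_space" and \<phi> \<phi>' :: "real \<Rightarrow> real"
  assumes h: "h \<in> borel_measurable (lebesgue_on T)"
    and S: "S \<in> sets lebesgue" and T: "T \<in> sets lebesgue" and E: "negligible E"
    and maps: "\<phi> ` S \<subseteq> T"
    and deriv: "\<And>x. x \<in> S \<Longrightarrow> (\<phi> has_real_derivative \<phi>' x) (at x within S)"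
    and nonzero: "\<And>x. x \<in> S - E \<Longrightarrow> \<phi>' x \<noteq> 0"
  shows "(\<lambda>x. h (\<phi> x)) \<in> borel_measurable (lebesgue_on S)"
proof -
  have "continuous_on S \<phi>"
    using deriv by (intro DERIV_continuous_on)
  then have "\<phi> \<in> borel_measurable (lebesgue_on S)"
    using S by (rule continuous_imp_measurable_on_sets_lebesgue)
  moreover have "{x \<in> S. \<phi> x \<in> U} \<in> sets lebesgue" if "negligible U" for U
  proof -
    \<comment> \<open>Off \<open>E\<close> the derivative is multiplication by a nonzero number,
      hence an injective linear map, so the preimage of the null set \<open>U\<close> is null there;
      adding \<open>E\<close> back costs only a null set.\<close>
    have "negligible {x \<in> S - E. \<phi> x \<in> U}"
    proof (rule negligible_differentiable_vimage[OF that])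
      fix x assume x: "x \<in> S - E"
      show "inj ((*) (\<phi>' x))"
        using nonzero[OF x] by (auto intro: injI)
      show "(\<phi> has_derivative (*) (\<phi>' x)) (at x within S - E)"
        using deriv[of x] x
        by (auto simp: has_field_derivative_def intro: has_derivative_subset)
    qed
    then have "negligible ({x \<in> S - E. \<phi> x \<in> U} \<union> E)"
      using E by (rule negligible_Un)
    then have "negligible {x \<in> S. \<phi> x \<in> U}"
      by (rule negligible_subset) auto
    then show ?thesis by (rule negligible_imp_sets)
  qed
  \<comment> \<open>A Lebesgue set is a Borel set up to a null set. Continuity takes care of the
    Borel part and the previous step of the null part; \<open>double_lebesgue_sets\<close> combines
    the two.\<close>
  ultimately have pre: "{x \<in> S. \<phi> x \<in> U} \<in> sets lebesgue" if "U \<in> sets lebesgue" "U \<subseteq> T" for U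
    using that double_lebesgue_sets[OF S T maps] by blast
  have "{x \<in> S. h (\<phi> x) \<in> V} \<in> sets lebesgue" if "V \<in> sets borel" for V
  proof -
    have "{y \<in> T. h y \<in> V} \<in> sets lebesgue"
      using h that by (simp add: borel_measurable_lebesgue_on_preimage_borel[OF T])
    then have "{x \<in> S. \<phi> x \<in> {y \<in> T. h y \<in> V}} \<in> sets lebesgue"
      by (rule pre) auto
    also have "{x \<in> S. \<phi> x \<in> {y \<in> T. h y \<in> V}} = {x \<in> S. h (\<phi> x) \<in> V}"
      using maps by auto
    finally show ?thesis .
  qed
  then show ?thesis
    by (simp add: borel_measurable_lebesgue_on_preimage_borel[OF S])
qed

text \<open>The substitution t = (x - a) / (b - a) on the whole line, applied to \<open>u\<close>
  cut off outside the unit interval: it turns the indicator of [0, 1] into that of [a, b]. It brings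
  the integrals over t to the domain of the integrals over x, also when they diverge.\<close>

lemma nn_integral_lebesgue_unit_interval_affine:
  fixes u :: "real \<Rightarrow> real" and a b :: real
  assumes u: "u \<in> borel_measurable (lebesgue_on {0..1})" and "a < b"
  shows "(\<integral>\<^sup>+t\<in>{0..1}. ennreal (u t) \<partial>lebesgue) =
    ennreal (1 / (b - a)) * (\<integral>\<^sup>+x. ennreal (u ((x - a) / (b - a))) \<partial>lebesgue_on {a..b})"
proof -
  let ?v = "\<lambda>t. ennreal (u t) * indicator {0..1} t"
  have "(\<lambda>t. ennreal (u t)) \<in> borel_measurable (lebesgue_on {0..1})"
    using u by simp
  then have "?v \<in> borel_measurable lebesgue"
    by (subst (asm) borel_measurable_restrict_space_iff_ennreal) auto
  from nn_integral_real_affine_lebesgue[OF this, of "1 / (b - a)" "- a / (b - a)"] \<open>a < b\<close>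
  have "(\<integral>\<^sup>+t. ?v t \<partial>lebesgue) =
      ennreal (1 / (b - a)) * (\<integral>\<^sup>+x. ?v (- a / (b - a) + 1 / (b - a) * x) \<partial>lebesgue)"
    by simp
  also have "(\<lambda>x. ?v (- a / (b - a) + 1 / (b - a) * x)) =
      (\<lambda>x. ennreal (u ((x - a) / (b - a))) * indicator {a..b} x)"
  proof
    fix x
    have "- a / (b - a) + 1 / (b - a) * x = (x - a) / (b - a)"
      by (simp add: diff_divide_distrib)
    moreover have "(x - a) / (b - a) \<in> {0..1} \<longleftrightarrow> x \<in> {a..b}"
      using \<open>a < b\<close> by (auto simp: field_simps)
    ultimately show "?v (- a / (b - a) + 1 / (b - a) * x) =
        ennreal (u ((x - a) / (b - a))) * indicator {a..b} x"
      by (simp only: indicator_def)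
  qed
  finally show ?thesis
    by (simp add: nn_integral_restrict_space)
qed

lemma super_multiplicative_on_powr:
  assumes "super_multiplicative_on J h" and "\<And>x. x \<in> J \<Longrightarrow> 0 \<le> h x"
    and "x \<in> J" "y \<in> J" "x * y \<in> J" and "0 \<le> s"
  shows "h x powr s * h y powr s \<le> h (x * y) powr s"
proof -
  have "h x powr s * h y powr s = (h x * h y) powr s"
    using assms by (simp add: powr_mult)
  also have "\<dots> \<le> h (x * y) powr s"
    using assms by (intro powr_mono2) (auto simp: super_multiplicative_on_def)
  finally show ?thesis .
qed

text \<open>The inequality before integration. Below, \<open>p\<close> and \<open>q\<close> are the
  weights of \<open>b\<close> and \<open>a\<close>, so that F = p f(b) + q f(a) and G = p g(b) + q
  g(a).\<close>

lemma similarly_ordered_SX2_product_bound: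
  assumes J: "{0..1} \<subseteq> J" and h0: "\<And>x. x \<in> J \<Longrightarrow> 0 \<le> h x" and s: "0 \<le> s"
    and f: "f \<in> SX2 h s I" and g: "g \<in> SX2 h s I"
    and sm: "super_multiplicative_on J h" and so: "similarly_ordered_on I f g"
    and a: "a \<in> I" and b: "b \<in> I" and t: "t \<in> {0..1}" and x: "x = t * b + (1 - t) * a"
  shows "g b * (h t powr s * f x) + g a * (h (1 - t) powr s * f x)
       + f b * (h t powr s * g x) + f a * (h (1 - t) powr s * g x)
     \<le> f x * g x + f b * g b * (h (t - t\<^sup>2) powr s + h (t\<^sup>2) powr s)
       + f a * g a * (h ((1 - t)\<^sup>2) powr s + h (t - t\<^sup>2) powr s)"
proof -
  define p q where "p = h t powr s" and "q = h (1 - t) powr s"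
  have nonneg: "0 \<le> f a" "0 \<le> f b" "0 \<le> g a" "0 \<le> g b" "0 \<le> p" "0 \<le> q"
    using f g a b by (auto simp: SX2_def p_def q_def)
  have "f x \<le> p * f b + q * f a" "g x \<le> p * g b + q * g a"
    using f g a b t by (auto simp: SX2_def x p_def q_def)
  then have "0 \<le> (p * f b + q * f a - f x) * (p * g b + q * g a - g x)"
    by simp
  then have 1: "g b * (p * f x) + g a * (q * f x) + f b * (p * g x) + f a * (q * g x)
      \<le> f x * g x + (p * f b + q * f a) * (p * g b + q * g a)"
    by (simp add: algebra_simps)
  \<comment> \<open>Similar ordering is a rearrangement inequality: the mixed products f(b) g(a) +
    f(a) g(b), which carry the weight \<open>p * q\<close> in F G, are at most f(b) g(b) + f(a)
    g(a).\<close>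
  have "0 \<le> (f b - f a) * (g b - g a)"
    using so a b by (auto simp: similarly_ordered_on_def)
  then have "p * q * (f b * g a + f a * g b) \<le> p * q * (f b * g b + f a * g a)"
    using nonneg by (intro mult_left_mono) (auto simp: algebra_simps)
  then have 2: "(p * f b + q * f a) * (p * g b + q * g a)
      \<le> f b * g b * (p * q + p * p) + f a * g a * (q * q + p * q)"
    by (simp add: algebra_simps)
  \<comment> \<open>Super-multiplicativity yields an inequality only if the product lies in
    \<open>J\<close>. The factors here are t and 1 - t, whose products stay in the unit interval and
    hence in \<open>J\<close>.\<close>
  have in_J: "y \<in> J" if "y \<in> {0..1}" for y
    using J that by auto
  have prod_J: "y \<in> J \<and> z \<in> J \<and> y * z \<in> J" if "y \<in> {0..1}" "z \<in> {0..1}" for y z :: real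
    using that by (auto intro!: in_J mult_le_one)
  have powr: "h y powr s * h z powr s \<le> h (y * z) powr s"
    if "y \<in> {0..1}" "z \<in> {0..1}" for y z
    using prod_J[OF that] s by (intro super_multiplicative_on_powr[OF sm h0]) auto
  have t': "1 - t \<in> {0..1}"
    using t by auto
  have "t * (1 - t) = t - t\<^sup>2"
    by (simp add: power2_eq_square algebra_simps)
  with powr[OF t t] powr[OF t t'] powr[OF t' t']
  have "p * p \<le> h (t\<^sup>2) powr s" "p * q \<le> h (t - t\<^sup>2) powr s" "q * q \<le> h ((1 - t)\<^sup>2) powr s"
    by (simp_all add: p_def q_def power2_eq_square)
  then have "f b * g b * (p * q + p * p) + f a * g a * (q * q + p * q)
      \<le> f b * g b * (h (t - t\<^sup>2) powr s + h (t\<^sup>2) powr s)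
        + f a * g a * (h ((1 - t)\<^sup>2) powr s + h (t - t\<^sup>2) powr s)"
    using nonneg by (intro add_mono mult_left_mono) auto
  with 1 2 show ?thesis
    unfolding p_def q_def by linarith
qed

theorem theorem8:
  fixes J :: "real set" and h f g :: "real \<Rightarrow> real" and s a b :: real
  assumes "{0..1} \<subseteq> J"
    and "\<And>x. x \<in> J \<Longrightarrow> 0 \<le> h x"
    and "\<exists>x\<in>J. h x \<noteq> 0"
    and "0 < s" and "s \<le> 1"
    and "f \<in> SX2 h s {0..}" and "g \<in> SX2 h s {0..}"
    and "super_multiplicative_on J h"
    and "similarly_ordered_on {0..} f g"
    and "a \<in> {0..}" and "b \<in> {0..}" and "a < b"
    and "set_integrable lebesgue {a..b} f"
    and "set_integrable lebesgue {a..b} g"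
    and "set_integrable lebesgue {a..b} (\<lambda>x. f x * g x)"
    and "set_integrable lebesgue {0..1} h"
  shows
    "ennreal (g b / (b - a)) *
       (\<integral>\<^sup>+x\<in>{a..b}. ennreal (h ((x - a) / (b - a)) powr s * f x) \<partial>lebesgue)
     + ennreal (g a / (b - a)) *
       (\<integral>\<^sup>+x\<in>{a..b}. ennreal (h ((b - x) / (b - a)) powr s * f x) \<partial>lebesgue)
     + ennreal (f b / (b - a)) *
       (\<integral>\<^sup>+x\<in>{a..b}. ennreal (h ((x - a) / (b - a)) powr s * g x) \<partial>lebesgue)
     + ennreal (f a / (b - a)) *
       (\<integral>\<^sup>+x\<in>{a..b}. ennreal (h ((b - x) / (b - a)) powr s * g x) \<partial>lebesgue)
     \<le> ennreal (1 / (b - a)) * (\<integral>\<^sup>+x\<in>{a..b}. ennreal (f x * g x) \<partial>lebesgue)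
     + ennreal (f b * g b) *
       (\<integral>\<^sup>+t\<in>{0..1}. ennreal (h (t - t\<^sup>2) powr s + h (t\<^sup>2) powr s) \<partial>lebesgue)
     + ennreal (f a * g a) *
       (\<integral>\<^sup>+t\<in>{0..1}. ennreal (h ((1 - t)\<^sup>2) powr s + h (t - t\<^sup>2) powr s) \<partial>lebesgue)"
proof -
  note J = assms(1) and h0 = assms(2) and f = assms(6) and g = assms(7) and \<open>a < b\<close>
  \<comment> \<open>All integrals are moved to the one measure \<open>M\<close>, with
    \<open>\<tau> x\<close> the parameter t of the point x and \<open>K\<close> the Jacobian of the
    substitution, so that a pointwise inequality can be integrated.\<close>
  define M where "M = lebesgue_on {a..b}"
  define K where "K = 1 / (b - a)"
  define \<tau> where "\<tau> = (\<lambda>x. (x - a) / (b - a))"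
  define H where "H = (\<lambda>t. h t powr s)"
  define A where "A = (\<lambda>t. H (t - t\<^sup>2) + H (t\<^sup>2))"
  define B where "B = (\<lambda>t. H ((1 - t)\<^sup>2) + H (t - t\<^sup>2))"
  have K: "0 < K" and a: "a \<ge> 0" and b: "b \<ge> 0"
    using assms by (auto simp: K_def)
  have \<tau>: "\<tau> x \<in> {0..1}" if "x \<in> {a..b}" for x
    using that \<open>a < b\<close> by (auto simp: \<tau>_def field_simps)
  have one_minus_\<tau>: "1 - \<tau> x = (b - x) / (b - a)" for x
    using \<open>a < b\<close> by (simp add: \<tau>_def field_simps)
  have convex_\<tau>: "x = \<tau> x * b + (1 - \<tau> x) * a" for x
  proof -
    have "\<tau> x * (b - a) = x - a"
      using \<open>a < b\<close> by (simp add: \<tau>_def)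
    then show ?thesis by (simp add: algebra_simps)
  qed

  have meas_on: "u \<in> borel_measurable (lebesgue_on {c..d})"
    if "set_integrable lebesgue {c..d} u" for u :: "real \<Rightarrow> real" and c d
    using that by (subst borel_measurable_restrict_space_iff)
      (auto simp: set_integrable_def)
  have f_meas [measurable]: "f \<in> borel_measurable M" and g_meas [measurable]: "g \<in> borel_measurable M"
    using assms by (auto simp: M_def intro: meas_on)
  have "h \<in> borel_measurable (lebesgue_on {0..1})"
    using assms by (auto intro: meas_on)
  then have H_meas: "H \<in> borel_measurable (lebesgue_on {0..1})"
    unfolding H_def by measurable
  \<comment> \<open>In the next three uses \<open>E\<close> is the zero set of the derivative: 1/2
    for t - t^2, 0 for t^2 and 1 for (1 - t)^2. The affine maps \<open>\<tau>\<close> and 1 -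
    \<open>\<tau>\<close> have slopes \<open>K\<close> and \<open>- K\<close>, so there
    \<open>E\<close> is empty.\<close>
  note compose = borel_measurable_lebesgue_on_compose_differentiable[where T = "{0..1}"]
  have H1: "(\<lambda>t. H (t - t\<^sup>2)) \<in> borel_measurable (lebesgue_on {0..1})"
  proof (rule compose[OF H_meas, where E = "{1/2}" and \<phi>' = "\<lambda>t. 1 - 2 * t"])
    have "t - t\<^sup>2 \<in> {0..1}" if "t \<in> {0..1}" for t :: real
    proof -
      have "0 \<le> t * t" "t * t \<le> t"
        using that by (auto simp: mult_left_le)
      with that show ?thesis
        unfolding power2_eq_square atLeastAtMost_iff by linarith
    qed
    then show "(\<lambda>t. t - t\<^sup>2) ` {0..1} \<subseteq> {0..1::real}"
      by blast
  qed (auto intro!: derivative_eq_intros)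
  have H2: "(\<lambda>t. H (t\<^sup>2)) \<in> borel_measurable (lebesgue_on {0..1})"
    by (rule compose[OF H_meas, where E = "{0}" and \<phi>' = "\<lambda>t. 2 * t"])
      (auto intro!: derivative_eq_intros simp: power_le_one)
  have H3: "(\<lambda>t. H ((1 - t)\<^sup>2)) \<in> borel_measurable (lebesgue_on {0..1})"
    by (rule compose[OF H_meas, where E = "{1}" and \<phi>' = "\<lambda>t. - 2 * (1 - t)"])
      (auto intro!: derivative_eq_intros simp: power_le_one)
  have A_meas: "A \<in> borel_measurable (lebesgue_on {0..1})"
    and B_meas: "B \<in> borel_measurable (lebesgue_on {0..1})"
    unfolding A_def B_def using H1 H2 H3 by simp_all
  have compose_\<tau>: "(\<lambda>x. u (\<tau> x)) \<in> borel_measurable M"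
    if "u \<in> borel_measurable (lebesgue_on {0..1})" for u :: "real \<Rightarrow> real"
    unfolding M_def
    by (rule compose[OF that, where E = "{}" and \<phi>' = "\<lambda>_. K"])
      (use \<tau> K in \<open>auto simp: \<tau>_def K_def intro!: derivative_eq_intros\<close>)
  have [measurable]: "(\<lambda>x. H (\<tau> x)) \<in> borel_measurable M"
    "(\<lambda>x. A (\<tau> x)) \<in> borel_measurable M" "(\<lambda>x. B (\<tau> x)) \<in> borel_measurable M"
    using H_meas A_meas B_meas by (auto intro: compose_\<tau>)
  have [measurable]: "(\<lambda>x. H (1 - \<tau> x)) \<in> borel_measurable M"
    unfolding M_def
    by (rule compose[OF H_meas, where E = "{}" and \<phi>' = "\<lambda>_. - K"])
      (use \<tau> K in \<open>auto simp: \<tau>_def K_def intro!: derivative_eq_intros\<close>)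

  have f0: "0 \<le> f x" and g0: "0 \<le> g x" if "x \<ge> 0" for x
    using f g that by (auto simp: SX2_def)
  have H0: "0 \<le> H t" "0 \<le> A t" "0 \<le> B t" for t
    by (simp_all add: H_def A_def B_def)
  have space_M: "0 \<le> f x" "0 \<le> g x" "x \<in> {a..b}" if "x \<in> space M" for x
    using that a f0 g0 by (auto simp: M_def)
  have to_M: "ennreal c * (\<integral>\<^sup>+x\<in>{a..b}. ennreal (u x) \<partial>lebesgue) = (\<integral>\<^sup>+x. ennreal (c * u x) \<partial>M)"
    if "u \<in> borel_measurable M" "0 \<le> c" for c and u :: "real \<Rightarrow> real"
  proof -
    have "(\<integral>\<^sup>+x\<in>{a..b}. ennreal (u x) \<partial>lebesgue) = (\<integral>\<^sup>+x. ennreal (u x) \<partial>M)"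
      by (simp add: M_def nn_integral_restrict_space)
    then show ?thesis
      using that by (simp add: nn_integral_cmult ennreal_mult')
  qed
  \<comment> \<open>The substitution contributes the factor \<open>K\<close>, which is the common
    factor 1 / (b - a) of the integrals over [a, b].\<close>
  have unit_to_M: "ennreal c * (\<integral>\<^sup>+t\<in>{0..1}. ennreal (u t) \<partial>lebesgue)
      = (\<integral>\<^sup>+x. ennreal (K * (c * u (\<tau> x))) \<partial>M)"
    if "u \<in> borel_measurable (lebesgue_on {0..1})" "0 \<le> c" for c and u :: "real \<Rightarrow> real"
    using that K compose_\<tau>[OF that(1)]
    by (simp add: nn_integral_lebesgue_unit_interval_affine[OF that(1) \<open>a < b\<close>]
        flip: M_def K_def \<tau>_def)
      (simp add: \<tau>_def nn_integral_cmult ennreal_mult' mult.left_commute)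

  \<comment> \<open>Additivity of the nonnegative integral needs measurability of the summands but
    no finiteness.\<close>
  have "(\<integral>\<^sup>+x. ennreal (K * g b * (H (\<tau> x) * f x)) \<partial>M)
      + (\<integral>\<^sup>+x. ennreal (K * g a * (H (1 - \<tau> x) * f x)) \<partial>M)
      + (\<integral>\<^sup>+x. ennreal (K * f b * (H (\<tau> x) * g x)) \<partial>M)
      + (\<integral>\<^sup>+x. ennreal (K * f a * (H (1 - \<tau> x) * g x)) \<partial>M)
    = (\<integral>\<^sup>+x. ennreal (K * g b * (H (\<tau> x) * f x)) + ennreal (K * g a * (H (1 - \<tau> x) * f x))
        + ennreal (K * f b * (H (\<tau> x) * g x)) + ennreal (K * f a * (H (1 - \<tau> x) * g x)) \<partial>M)"
    by (simp add: nn_integral_add)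
  also have "\<dots> \<le> (\<integral>\<^sup>+x. ennreal (K * (f x * g x)) + ennreal (K * (f b * g b * A (\<tau> x)))
        + ennreal (K * (f a * g a * B (\<tau> x))) \<partial>M)"
  proof (rule nn_integral_mono)
    fix x assume "x \<in> space M"
    note x = space_M[OF this]
    have "K * (g b * (H (\<tau> x) * f x) + g a * (H (1 - \<tau> x) * f x)
        + f b * (H (\<tau> x) * g x) + f a * (H (1 - \<tau> x) * g x))
      \<le> K * (f x * g x + f b * g b * A (\<tau> x) + f a * g a * B (\<tau> x))"
      unfolding H_def A_def B_def
      by (intro mult_left_mono similarly_ordered_SX2_product_bound[OF J h0 _ f g])
        (use assms K \<tau>[OF x(3)] convex_\<tau>[of x] in auto)
    \<comment> \<open>\<open>ennreal\<close> truncates negative numbers to 0, so it commutes with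
      these sums because every summand is nonnegative.\<close>
    then show "ennreal (K * g b * (H (\<tau> x) * f x)) + ennreal (K * g a * (H (1 - \<tau> x) * f x))
        + ennreal (K * f b * (H (\<tau> x) * g x)) + ennreal (K * f a * (H (1 - \<tau> x) * g x))
      \<le> ennreal (K * (f x * g x)) + ennreal (K * (f b * g b * A (\<tau> x)))
        + ennreal (K * (f a * g a * B (\<tau> x)))"
      using K x f0[OF a] f0[OF b] g0[OF a] g0[OF b] H0
      by (simp add: distrib_left mult.assoc flip: ennreal_plus)
  qed
  \<comment> \<open>Splitting the right-hand side relies on the measurability of
    \<open>A (\<tau> x)\<close> and \<open>B (\<tau> x)\<close>, that is, on the composition
    lemma.\<close>
  also have "\<dots> = (\<integral>\<^sup>+x. ennreal (K * (f x * g x)) \<partial>M)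
      + (\<integral>\<^sup>+x. ennreal (K * (f b * g b * A (\<tau> x))) \<partial>M)
      + (\<integral>\<^sup>+x. ennreal (K * (f a * g a * B (\<tau> x))) \<partial>M)"
    by (simp add: nn_integral_add)
  finally have "ennreal (K * g b) * (\<integral>\<^sup>+x\<in>{a..b}. ennreal (H (\<tau> x) * f x) \<partial>lebesgue)
      + ennreal (K * g a) * (\<integral>\<^sup>+x\<in>{a..b}. ennreal (H (1 - \<tau> x) * f x) \<partial>lebesgue)
      + ennreal (K * f b) * (\<integral>\<^sup>+x\<in>{a..b}. ennreal (H (\<tau> x) * g x) \<partial>lebesgue)
      + ennreal (K * f a) * (\<integral>\<^sup>+x\<in>{a..b}. ennreal (H (1 - \<tau> x) * g x) \<partial>lebesgue)
    \<le> ennreal K * (\<integral>\<^sup>+x\<in>{a..b}. ennreal (f x * g x) \<partial>lebesgue)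
      + ennreal (f b * g b) * (\<integral>\<^sup>+t\<in>{0..1}. ennreal (A t) \<partial>lebesgue)
      + ennreal (f a * g a) * (\<integral>\<^sup>+t\<in>{0..1}. ennreal (B t) \<partial>lebesgue)"
    using K f0[OF a] f0[OF b] g0[OF a] g0[OF b]
    by (simp add: to_M unit_to_M A_meas B_meas)
  \<comment> \<open>\<open>1 - \<tau> x\<close> is rewritten to (b - x) / (b - a) first, while
    \<open>\<tau>\<close> is still folded.\<close>
  then show ?thesis
    unfolding one_minus_\<tau> unfolding H_def A_def B_def K_def \<tau>_def by simp
qed

end
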